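(* Let $K\ge 1$, $\mathcal K=\{1,\dots,K\}$, let $\mathcal N\subseteq\mathcal K$ be the set of indices of true null hypotheses, $K_0=|\mathcal N|$, and let $\mathbf P=(P_1,\dots,P_K)$ be a random vector of p-values on a probability space with probability measure $\mathbb P$, where $P_k$ is a p-variable for every $k\in\mathcal N$. Suppose that $P_1,\dots,P_K$ satisfy positive regression dependence on the subset $\mathcal N$ (PRDS). Let $\alpha\in(0,1)$ and let $\mathcal D$ be the Benjamini-Hochberg (BH) procedure at level $\alpha$ applied to $\mathbf P$. Then $$\mathrm{FDR}_{\mathcal D}=\mathbb E\left[\frac{F_{\mathcal D}}{R_{\mathcal D}\vee 1}\right]\le\frac{\alpha K_0}{K}.$$
   Context: Hypotheses $H_1,\dots,H_K$ are tested; $\mathcal N\subseteq\mathcal K$ is the (deterministic) set of indices of the true null hypotheses. For each $k\in\mathcal K$, $P_k$ is a $[0,\infty)$-valued random variable (the p-value of $H_k$). A p-variable is a random variable $P$ with $\mathbb P(P\le t)\le t$ for all $t\in(0,1)$. The p-values with $k\notin\mathcal N$ need not be p-variables. PRDS: vector inequalities are component-wise and "increasing" is in the non-strict sense. A set $A\subseteq\mathbb R^K$ is increasing if $\mathbf x\in A$ implies $\mathbf y\in A$ for all $\mathbf y\ge\mathbf x$. The p-values $P_1,\dots,P_K$ satisfy PRDS if for any $k\in\mathcal N$ and any increasing (Borel) set $A\subseteq\mathbb R^K$, the function $x\mapsto\mathbb P(\mathbf P\in A\mid P_k\le x)$ is increasing, on the set of $x$ with $\mathbb P(P_k\le x)>0$,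 where it is defined. A testing procedure is a map $\mathcal D:[0,\infty)^K\to 2^{\mathcal K}$ that takes the p-values as input and returns the set of indices of rejected hypotheses. $\mathcal D$ is identified with its random output $\mathcal D(\mathbf P)$. $R_{\mathcal D}=|\mathcal D|$ is the number of discoveries and $F_{\mathcal D}=|\mathcal D\cap\mathcal N|$ is the number of false discoveries. The false discovery rate is $\mathrm{FDR}_{\mathcal D}=\mathbb E[F_{\mathcal D}/(R_{\mathcal D}\vee 1)]$, with expectation under $\mathbb P$; here $x\vee y=\max(x,y)$. BH procedure at level $\alpha$: for input $(p_1,\dots,p_K)$ let $p_{(1)}\le\dots\le p_{(K)}$ be the order statistics from smallest to largest and let $$k^*=\max\left\{k\in\mathcal K:\frac{K p_{(k)}}{k}\le\alpha\right\},\qquad \max(\varnothing)=0.$$ The procedure rejects the hypotheses with the $k^*$ smallest p-values and accepts the rest, i.e. the output is $\{k\in\mathcal K: p_k\le p_{(k^* )}\}$ if $k^*\ge 1$ and $\varnothing$ if $k^*=0$ (by maximality of $k^*$ there is no tie between $p_{(k^* )}$ and $p_{(k^*+1)}$). *)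

theory Defs
  imports "HOL-Probability.Probability"
begin

text \<open>
  Hypotheses are indexed by a finite type \<open>'k\<close>, so \<open>K = CARD('k) \<ge> 1\<close>, and a vector of
  p-values is an element of \<open>real ^ 'k\<close>, whose library order is component-wise.
\<close>

definition p_variable :: "'a measure \<Rightarrow> ('a \<Rightarrow> real) \<Rightarrow> bool" where
  "p_variable M X \<longleftrightarrow>
     X \<in> borel_measurable M \<and> (\<forall>t\<in>{0<..<1}. \<P>(\<omega> in M. X \<omega> \<le> t) \<le> t)"

definition increasing_set :: "('b::order) set \<Rightarrow> bool" where
  "increasing_set A \<longleftrightarrow> (\<forall>x\<in>A. \<forall>y\<ge>x. y \<in> A)"

definition PRDS :: "'a measure \<Rightarrow> ('a \<Rightarrow> real ^ 'k::finite) \<Rightarrow> 'k set \<Rightarrow> bool" where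
  "PRDS M P N \<longleftrightarrow>
     (\<forall>k\<in>N. \<forall>A\<in>sets borel. increasing_set A \<longrightarrow>
        mono_on {x. \<P>(\<omega> in M. P \<omega> $ k \<le> x) > 0}
          (\<lambda>x. \<P>(\<omega> in M. P \<omega> \<in> A \<bar> P \<omega> $ k \<le> x)))"

text \<open>
  The order statistics are indexed from 1 as usual, hence the shift in the list index; only
  \<open>1 \<le> j \<le> CARD('k)\<close> is meaningful.
\<close>

definition order_stat :: "real ^ 'k::finite \<Rightarrow> nat \<Rightarrow> real" where
  "order_stat p j = sorted_list_of_multiset (image_mset (\<lambda>i. p $ i) (mset_set UNIV)) ! (j - 1)"

definition BH_index :: "real \<Rightarrow> real ^ 'k::finite \<Rightarrow> nat" where
  "BH_index \<alpha> p =
     (let S = {j \<in> {1..CARD('k)}. real CARD('k) * order_stat p j / real j \<le> \<alpha>}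
      in if S = {} then 0 else Max S)"

definition BH :: "real \<Rightarrow> real ^ 'k::finite \<Rightarrow> 'k set" where
  "BH \<alpha> p =
     (if BH_index \<alpha> p = 0 then {} else {i. p $ i \<le> order_stat p (BH_index \<alpha> p)})"

definition num_discoveries :: "'k::finite set \<Rightarrow> nat" where
  "num_discoveries D = card D"

definition num_false_discoveries :: "'k::finite set \<Rightarrow> 'k set \<Rightarrow> nat" where
  "num_false_discoveries N D = card (D \<inter> N)"

definition FDR ::
  "'a measure \<Rightarrow> ('a \<Rightarrow> real ^ 'k::finite) \<Rightarrow> 'k set \<Rightarrow> (real ^ 'k \<Rightarrow> 'k set) \<Rightarrow> real" where
  "FDR M P N \<D> =
     (\<integral>\<omega>. real (num_false_discoveries N (\<D> (P \<omega>))) / real (max (num_discoveries (\<D> (P \<omega>))) 1) \<partial>M)"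

end

theory Submission
  imports Defs
begin

text \<open>
  Write \<open>t\<^sub>r = \<alpha> r / K\<close> and let \<open>R\<close> be the number of discoveries. Two properties of the
  Benjamini-Hochberg procedure carry the proof. It is self-consistent: when \<open>R \<ge> 1\<close>, hypothesis
  \<open>k\<close> is rejected iff \<open>P\<^sub>k \<le> t\<^sub>R\<close> (\<open>BH_self_consistent\<close>). And it is monotone: larger p-values
  can only decrease \<open>R\<close>, so each event \<open>R \<le> r\<close> is given by an increasing set of p-value vectors
  (\<open>increasing_BH_index_le\<close>). By self-consistency the false discovery proportion is
  \<open>\<Sum>k\<in>N. \<Sum>r=1..K. 1{P\<^sub>k \<le> t\<^sub>r, R = r} / r\<close>, so it suffices to bound the expectation of the inner
  sum by \<open>\<alpha> / K\<close> for each true null \<open>k\<close>.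

  Fix such a \<open>k\<close> and put \<open>a r = \<P>(R \<le> r | P\<^sub>k \<le> t\<^sub>r)\<close>. Since \<open>\<P>(P\<^sub>k \<le> t\<^sub>r) \<le> t\<^sub>r\<close>,

  \<open>\<P>(P\<^sub>k \<le> t\<^sub>r, R = r) / r \<le> \<alpha> / K * (a r - \<P>(R \<le> r - 1 | P\<^sub>k \<le> t\<^sub>r)) \<le> \<alpha> / K * (a r - a (r - 1))\<close>,

  where the last inequality is PRDS applied to the increasing event \<open>R \<le> r - 1\<close> and the levels
  \<open>t\<^sub>r\<^sub>-\<^sub>1 \<le> t\<^sub>r\<close>. This is \<open>BH_null_increment\<close>. The right-hand sides telescope to at most
  \<open>\<alpha> / K\<close> because \<open>0 \<le> a r \<le> 1\<close>.
\<close>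

section \<open>Order statistics as counts\<close>

lemma sorted_nth_le_iff_less_length_filter:
  fixes t :: "'a::linorder"
  assumes "sorted xs" "j < length xs"
  shows "xs ! j \<le> t \<longleftrightarrow> j < length (filter (\<lambda>x. x \<le> t) xs)"
  using assms
proof (induction xs arbitrary: j)
  case Nil
  then show ?case by simp
next
  case (Cons x xs)
  show ?case
  proof (cases "x \<le> t")
    case True
    then show ?thesis using Cons by (cases j) auto
  next
    case False
    then have "y \<in> set (x # xs) \<Longrightarrow> \<not> y \<le> t" for y
      using Cons.prems(1) by auto
    then have "filter (\<lambda>x. x \<le> t) (x # xs) = []" "\<not> (x # xs) ! j \<le> t"
      using nth_mem[of j "x # xs"] Cons.prems(2) by (auto simp: filter_empty_conv simp del: filter.simps)
    then show ?thesis by (metis length_0_conv not_less0)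
  qed
qed

lemma order_stat_le_iff:
  fixes p :: "real ^ 'k::finite"
  assumes "1 \<le> j" "j \<le> CARD('k)"
  shows "order_stat p j \<le> t \<longleftrightarrow> j \<le> card {i. p $ i \<le> t}"
proof -
  let ?A = "image_mset (\<lambda>i. p $ i) (mset_set (UNIV :: 'k set))"
  let ?xs = "sorted_list_of_multiset ?A"
  have len: "length ?xs = CARD('k)"
    by (metis mset_sorted_list_of_multiset size_mset size_image_mset size_mset_set)
  have "length (filter (\<lambda>x. x \<le> t) ?xs) = size (filter_mset (\<lambda>x. x \<le> t) ?A)"
    by (metis mset_filter mset_sorted_list_of_multiset size_mset)
  also have "\<dots> = card {i. p $ i \<le> t}"
    by (simp add: filter_mset_image_mset filter_mset_mset_set)
  finally have "length (filter (\<lambda>x. x \<le> t) ?xs) = card {i. p $ i \<le> t}" .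
  moreover have "?xs ! (j - 1) \<le> t \<longleftrightarrow> j - 1 < length (filter (\<lambda>x. x \<le> t) ?xs)"
    using assms len by (intro sorted_nth_le_iff_less_length_filter) auto
  ultimately show ?thesis
    using assms unfolding order_stat_def by auto
qed

section \<open>Self-consistency and monotonicity of the Benjamini-Hochberg procedure\<close>

definition BH_threshold :: "real \<Rightarrow> 'k::finite itself \<Rightarrow> nat \<Rightarrow> real" where
  "BH_threshold \<alpha> _ r = \<alpha> * real r / real CARD('k)"

lemma BH_threshold_mono:
  "0 \<le> \<alpha> \<Longrightarrow> r \<le> s \<Longrightarrow> BH_threshold \<alpha> TYPE('k::finite) r \<le> BH_threshold \<alpha> TYPE('k) s"
  by (simp add: BH_threshold_def divide_right_mono mult_left_mono)

text \<open>
  Replacing order statistics by counts makes the dependence on \<open>p\<close> visible: both the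
  monotonicity and the measurability of the rejection count are read off from this form.
\<close>

lemma BH_index_eq_Max_count:
  fixes p :: "real ^ 'k::finite"
  shows "BH_index \<alpha> p =
    (let S = {j \<in> {1..CARD('k)}. j \<le> card {i. p $ i \<le> BH_threshold \<alpha> TYPE('k) j}}
     in if S = {} then 0 else Max S)"
proof -
  have "real CARD('k) * order_stat p j / real j \<le> \<alpha> \<longleftrightarrow>
        j \<le> card {i. p $ i \<le> BH_threshold \<alpha> TYPE('k) j}"
    if "j \<in> {1..CARD('k)}" for j
  proof -
    have "real CARD('k) * order_stat p j / real j \<le> \<alpha> \<longleftrightarrow>
          order_stat p j \<le> BH_threshold \<alpha> TYPE('k) j"
      using that by (simp add: BH_threshold_def field_simps)
    then show ?thesis using that order_stat_le_iff[of j p] by simp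
  qed
  then have "{j \<in> {1..CARD('k)}. real CARD('k) * order_stat p j / real j \<le> \<alpha>} =
    {j \<in> {1..CARD('k)}. j \<le> card {i. p $ i \<le> BH_threshold \<alpha> TYPE('k) j}}"
    by blast
  then show ?thesis unfolding BH_index_def by simp
qed

lemma BH_index_le_iff:
  fixes p :: "real ^ 'k::finite"
  shows "BH_index \<alpha> p \<le> r \<longleftrightarrow>
    (\<forall>j\<in>{r<..CARD('k)}. card {i. p $ i \<le> BH_threshold \<alpha> TYPE('k) j} < j)"
proof -
  define S where
    "S = {j \<in> {1..CARD('k)}. j \<le> card {i. p $ i \<le> BH_threshold \<alpha> TYPE('k) j}}"
  have "BH_index \<alpha> p = (if S = {} then 0 else Max S)"
    unfolding BH_index_eq_Max_count S_def Let_def ..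
  moreover have "finite S" unfolding S_def by simp
  ultimately have "BH_index \<alpha> p \<le> r \<longleftrightarrow> (\<forall>j\<in>S. j \<le> r)" by auto
  also have "\<dots> \<longleftrightarrow>
    (\<forall>j\<in>{r<..CARD('k)}. card {i. p $ i \<le> BH_threshold \<alpha> TYPE('k) j} < j)"
    (is "_ \<longleftrightarrow> ?R")
  proof
    assume le: "\<forall>j\<in>S. j \<le> r"
    show ?R
    proof
      fix j assume "j \<in> {r<..CARD('k)}"
      then show "card {i. p $ i \<le> BH_threshold \<alpha> TYPE('k) j} < j"
        using bspec[OF le, of j] by (force simp: S_def not_less)
    qed
  next
    assume ?R
    then show "\<forall>j\<in>S. j \<le> r" by (force simp: S_def not_le[symmetric])
  qed
  finally show ?thesis .
qed

lemma BH_index_le_card: "BH_index \<alpha> (p :: real ^ 'k::finite) \<le> CARD('k)"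
  unfolding BH_index_le_iff by simp

text \<open>
  At the index \<open>m\<close> chosen by the procedure exactly \<open>m\<close> p-values lie below the threshold: a
  larger count \<open>c\<close> would satisfy the defining condition at \<open>c\<close> too, since thresholds increase,
  contradicting maximality. Hence cutting off at the \<open>m\<close>-th order statistic, as the definition
  does, gives the same set as cutting off at the threshold.
\<close>

lemma BH_self_consistent:
  fixes p :: "real ^ 'k::finite"
  assumes "0 \<le> \<alpha>"
  shows card_BH: "card (BH \<alpha> p) = BH_index \<alpha> p"
    and BH_eq_below_threshold: "BH_index \<alpha> p \<noteq> 0 \<Longrightarrow>
      BH \<alpha> p = {i. p $ i \<le> BH_threshold \<alpha> TYPE('k) (BH_index \<alpha> p)}"
proof -
  define m where "m = BH_index \<alpha> p"
  define below where "below j = {i. p $ i \<le> BH_threshold \<alpha> TYPE('k) j}" for j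
  have *: "card (BH \<alpha> p) = m \<and> BH \<alpha> p = below m" if "m \<noteq> 0"
  proof -
    have mK: "1 \<le> m" "m \<le> CARD('k)"
      using that BH_index_le_card[of \<alpha> p] by (auto simp: m_def)
    have "\<not> BH_index \<alpha> p \<le> m - 1" using mK by (simp add: m_def)
    then obtain j where j: "m - 1 < j" "j \<le> CARD('k)" "j \<le> card (below j)"
      unfolding BH_index_le_iff below_def by (auto simp: not_less)
    have above: "card (below i) < i" if "m < i" "i \<le> CARD('k)" for i
      using BH_index_le_iff[of \<alpha> p m] that by (auto simp: m_def below_def)
    have "j = m" using above[of j] j by (cases "m < j") auto
    with j have ge: "m \<le> card (below m)" by simp
    have "card (below m) \<le> m"
    proof (rule ccontr)
      let ?c = "card (below m)"
      assume "\<not> ?c \<le> m"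
      then have "below m \<subseteq> below ?c"
        using BH_threshold_mono[OF assms, of m ?c, where 'k = 'k]
        by (auto simp: below_def)
      then have "?c \<le> card (below ?c)" by (intro card_mono) auto
      moreover have "?c \<le> CARD('k)" by (intro card_mono) auto
      ultimately show False using above[of ?c] \<open>\<not> ?c \<le> m\<close> by simp
    qed
    with ge have cm: "card (below m) = m" by simp
    have os: "order_stat p m \<le> BH_threshold \<alpha> TYPE('k) m"
      using order_stat_le_iff[OF mK] ge by (simp add: below_def)
    have BH: "BH \<alpha> p = {i. p $ i \<le> order_stat p m}"
      using that by (simp add: BH_def m_def)
    have sub: "BH \<alpha> p \<subseteq> below m" using os by (auto simp: BH below_def)
    have "m \<le> card (BH \<alpha> p)"
      using order_stat_le_iff[OF mK, of p "order_stat p m"] by (simp add: BH)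
    then have "BH \<alpha> p = below m"
      using sub cm by (intro card_seteq) auto
    with cm show ?thesis by simp
  qed
  show "card (BH \<alpha> p) = BH_index \<alpha> p"
    using * by (cases "m = 0") (auto simp: m_def BH_def)
  show "BH_index \<alpha> p \<noteq> 0 \<Longrightarrow>
      BH \<alpha> p = {i. p $ i \<le> BH_threshold \<alpha> TYPE('k) (BH_index \<alpha> p)}"
    using * by (simp add: m_def below_def)
qed

lemma increasing_BH_index_le:
  "increasing_set {p :: real ^ 'k::finite. BH_index \<alpha> p \<le> r}"
proof -
  have "card {i. q $ i \<le> t} \<le> card {i. p $ i \<le> t}" if "p \<le> q" for p q :: "real ^ 'k" and t
    using that by (intro card_mono) (auto simp: less_eq_vec_def intro: order_trans)
  then show ?thesis
    unfolding increasing_set_def BH_index_le_iff by simp (meson le_less_trans)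
qed

text \<open>
  "At least \<open>j\<close> coordinates are \<open>\<le> t\<close>" is a finite union, over the sets of \<open>j\<close> or more indices,
  of closed orthants, and the event is a finite intersection of complements of such sets.
\<close>

lemma borel_BH_index_le:
  "{p :: real ^ 'k::finite. BH_index \<alpha> p \<le> r} \<in> sets borel"
proof -
  have "closed {p :: real ^ 'k. j \<le> card {i. p $ i \<le> t}}" for j t
  proof -
    have "{p :: real ^ 'k. j \<le> card {i. p $ i \<le> t}} =
      (\<Union>I\<in>{I. j \<le> card I}. {p. \<forall>i\<in>I. p $ i \<le> t})" (is "?L = ?R")
    proof (intro set_eqI iffI)
      fix p assume "p \<in> ?R"
      then obtain I where "j \<le> card I" "I \<subseteq> {i. p $ i \<le> t}" by auto
      then show "p \<in> ?L" using card_mono[of "{i. p $ i \<le> t}" I] by simp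
    qed auto
    moreover have "closed {p :: real ^ 'k. \<forall>i\<in>I. p $ i \<le> t}" for I
      by (simp add: Ball_def) (intro closed_Collect_all closed_Collect_imp open_Collect_const
        closed_Collect_le continuous_intros)
    ultimately show ?thesis by (auto intro!: closed_UN)
  qed
  then have "{p :: real ^ 'k. card {i. p $ i \<le> t} < j} \<in> sets borel" for j t
    using borel_closed[THEN borel_comp, of "{p :: real ^ 'k. j \<le> card {i. p $ i \<le> t}}"]
    by (simp add: Collect_neg_eq[symmetric] not_le)
  then have "{p :: real ^ 'k. p \<in> space borel \<and>
      (\<forall>j\<in>{r<..CARD('k)}. card {i. p $ i \<le> BH_threshold \<alpha> TYPE('k) j} < j)} \<in> sets borel"
    by (intro sets.sets_Collect_finite_All) auto
  then show ?thesis unfolding BH_index_le_iff by simp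
qed

lemma events_BH_index_le:
  assumes "P \<in> borel_measurable M"
  shows "{\<omega> \<in> space M. BH_index \<alpha> (P \<omega>) \<le> r} \<in> sets M"
  using measurable_sets[OF assms borel_BH_index_le[of \<alpha> r]]
  by (simp add: vimage_def Int_def conj_commute)

section \<open>Contribution of a single true null\<close>

text \<open>
  This is the step where both the p-variable property and PRDS enter. The convention \<open>x / 0 = 0\<close>
  makes conditional probabilities given null events vanish, so the bound also holds at levels
  below the essential infimum of \<open>P\<^sub>k\<close>, where PRDS is silent.
\<close>

lemma BH_null_increment:
  fixes P :: "'a \<Rightarrow> real ^ 'k::finite"
  assumes "prob_space M" and P: "P \<in> borel_measurable M"
    and pv: "p_variable M (\<lambda>\<omega>. P \<omega> $ k)" and "k \<in> N" and "PRDS M P N"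
    and \<alpha>: "0 < \<alpha>" "\<alpha> < 1" and r: "Suc r \<le> CARD('k)"
  defines "t \<equiv> BH_threshold \<alpha> TYPE('k)"
  defines "a \<equiv> \<lambda>s. \<P>(\<omega> in M. BH_index \<alpha> (P \<omega>) \<le> s \<bar> P \<omega> $ k \<le> t s)"
  shows "\<P>(\<omega> in M. P \<omega> $ k \<le> t (Suc r) \<and> BH_index \<alpha> (P \<omega>) = Suc r) / real (Suc r)
    \<le> \<alpha> / real CARD('k) * (a (Suc r) - a r)"
proof -
  interpret prob_space M by fact
  have [measurable]: "{\<omega> \<in> space M. BH_index \<alpha> (P \<omega>) \<le> s} \<in> events" for s
    using P by (rule events_BH_index_le)
  have [measurable]: "{\<omega> \<in> space M. P \<omega> $ k \<le> u} \<in> events" for u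
    using pv by (auto simp: p_variable_def)
  define c where "c = \<P>(\<omega> in M. P \<omega> $ k \<le> t (Suc r))"
  define b where "b = \<P>(\<omega> in M. BH_index \<alpha> (P \<omega>) \<le> r \<bar> P \<omega> $ k \<le> t (Suc r))"
  have t_pos: "0 < t (Suc r)" using \<alpha> by (simp add: t_def BH_threshold_def)
  have "t (Suc r) \<le> \<alpha>"
    using \<alpha> r by (simp add: t_def BH_threshold_def divide_simps mult_left_mono del: of_nat_Suc)
  then have "t (Suc r) \<in> {0<..<1}" using \<alpha> t_pos by simp
  then have c_le: "c \<le> t (Suc r)" using pv by (auto simp: p_variable_def c_def)
  have t_mono: "t r \<le> t (Suc r)" using \<alpha> by (simp add: t_def BH_threshold_mono)
  have c_mono: "\<P>(\<omega> in M. P \<omega> $ k \<le> t r) \<le> c"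
    unfolding c_def using t_mono by (intro finite_measure_mono) auto
  have "\<P>(\<omega> in M. P \<omega> $ k \<le> t (Suc r) \<and> BH_index \<alpha> (P \<omega>) = Suc r) =
      \<P>(\<omega> in M. BH_index \<alpha> (P \<omega>) \<le> Suc r \<and> P \<omega> $ k \<le> t (Suc r)) -
      \<P>(\<omega> in M. BH_index \<alpha> (P \<omega>) \<le> r \<and> P \<omega> $ k \<le> t (Suc r))"
    by (subst finite_measure_Diff[symmetric]) (auto intro!: arg_cong[where f = prob])
  (* Both joint probabilities are at most c, so the factorization survives c = 0. *)
  also have "\<dots> = c * (a (Suc r) - b)"
  proof (cases "c = 0")
    case True
    have "\<P>(\<omega> in M. BH_index \<alpha> (P \<omega>) \<le> s \<and> P \<omega> $ k \<le> t (Suc r)) \<le> c" for s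
      unfolding c_def by (intro finite_measure_mono) auto
    with True have "\<P>(\<omega> in M. BH_index \<alpha> (P \<omega>) \<le> s \<and> P \<omega> $ k \<le> t (Suc r)) = 0" for s
      by (simp add: measure_le_0_iff)
    with True show ?thesis by simp
  next
    case False
    then show ?thesis by (simp add: a_def b_def cond_prob_def c_def[symmetric] right_diff_distrib)
  qed
  finally have eq: "\<P>(\<omega> in M. P \<omega> $ k \<le> t (Suc r) \<and> BH_index \<alpha> (P \<omega>) = Suc r) =
      c * (a (Suc r) - b)" .
  have diff_nonneg: "0 \<le> a (Suc r) - b"
    unfolding a_def b_def cond_prob_def diff_divide_distrib[symmetric]
    by (intro divide_nonneg_nonneg) (auto intro!: finite_measure_mono)
  have a_le_b: "a r \<le> b"
  proof (cases "\<P>(\<omega> in M. P \<omega> $ k \<le> t r) > 0")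
    case True
    have "mono_on {x. \<P>(\<omega> in M. P \<omega> $ k \<le> x) > 0}
        (\<lambda>x. \<P>(\<omega> in M. P \<omega> \<in> {p. BH_index \<alpha> p \<le> r} \<bar> P \<omega> $ k \<le> x))"
      using \<open>PRDS M P N\<close> \<open>k \<in> N\<close> borel_BH_index_le increasing_BH_index_le
      unfolding PRDS_def by blast
    from mono_onD[OF this, of "t r" "t (Suc r)"] show ?thesis
      using True t_mono c_mono by (simp add: a_def b_def c_def)
  next
    case False
    then have "a r = 0" by (simp add: a_def cond_prob_def not_less measure_le_0_iff)
    then show ?thesis by (simp add: b_def cond_prob_def)
  qed
  (* t (Suc r) = \<alpha> * Suc r / K: dividing by Suc r leaves the same factor \<alpha> / K for every r,
     which is what allows the bounds to telescope. *)
  have "c * (a (Suc r) - b) \<le> t (Suc r) * (a (Suc r) - a r)"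
    using c_le diff_nonneg a_le_b t_pos by (intro mult_mono) auto
  then have "c * (a (Suc r) - b) / real (Suc r) \<le> t (Suc r) * (a (Suc r) - a r) / real (Suc r)"
    by (intro divide_right_mono) auto
  then show ?thesis
    unfolding eq by (simp add: t_def BH_threshold_def del: of_nat_Suc)
qed

lemma BH_null_contribution:
  fixes P :: "'a \<Rightarrow> real ^ 'k::finite"
  assumes "prob_space M" "P \<in> borel_measurable M"
    and "p_variable M (\<lambda>\<omega>. P \<omega> $ k)" "k \<in> N" "PRDS M P N" "0 < \<alpha>" "\<alpha> < 1"
  shows "(\<Sum>r<CARD('k). \<P>(\<omega> in M. P \<omega> $ k \<le> BH_threshold \<alpha> TYPE('k) (Suc r) \<and>
      BH_index \<alpha> (P \<omega>) = Suc r) / real (Suc r)) \<le> \<alpha> / real CARD('k)"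
proof -
  interpret prob_space M by fact
  define a where
    "a s = \<P>(\<omega> in M. BH_index \<alpha> (P \<omega>) \<le> s \<bar> P \<omega> $ k \<le> BH_threshold \<alpha> TYPE('k) s)" for s
  have "(\<Sum>r<CARD('k). \<P>(\<omega> in M. P \<omega> $ k \<le> BH_threshold \<alpha> TYPE('k) (Suc r) \<and>
      BH_index \<alpha> (P \<omega>) = Suc r) / real (Suc r)) \<le>
      (\<Sum>r<CARD('k). \<alpha> / real CARD('k) * (a (Suc r) - a r))"
    unfolding a_def using assms by (intro sum_mono BH_null_increment[where N = N]) auto
  also have "\<dots> = \<alpha> / real CARD('k) * (a CARD('k) - a 0)"
    by (simp only: sum_distrib_left[symmetric] sum_lessThan_telescope)
  also have "\<dots> \<le> \<alpha> / real CARD('k) * 1"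
  proof (intro mult_left_mono)
    have "a CARD('k) \<le> 1"
      unfolding a_def cond_prob_def by (simp add: BH_index_le_card divide_le_eq_1 measure_nonneg)
    moreover have "0 \<le> a 0" by (simp add: a_def cond_prob_def)
    ultimately show "a CARD('k) - a 0 \<le> 1" by simp
  qed (use \<open>0 < \<alpha>\<close> in auto)
  finally show ?thesis by simp
qed

section \<open>Control of the false discovery rate\<close>

text \<open>
  Splitting by the value of \<open>R\<close> replaces the random threshold and the random denominator by
  deterministic ones; that is what lets the expectation reduce to probabilities of events.
\<close>

lemma BH_false_discovery_proportion:
  fixes p :: "real ^ 'k::finite"
  assumes "0 \<le> \<alpha>"
  shows "real (num_false_discoveries N (BH \<alpha> p)) / real (max (num_discoveries (BH \<alpha> p)) 1) =
    (\<Sum>k\<in>N. \<Sum>r<CARD('k). of_bool (p $ k \<le> BH_threshold \<alpha> TYPE('k) (Suc r) \<and>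
      BH_index \<alpha> p = Suc r) / real (Suc r))"
proof (cases "BH_index \<alpha> p")
  case 0
  then show ?thesis by (simp add: num_false_discoveries_def BH_def)
next
  case (Suc m)
  define below where "below = {i. p $ i \<le> BH_threshold \<alpha> TYPE('k) (Suc m)}"
  have "m < CARD('k)" using BH_index_le_card[of \<alpha> p] Suc by simp
  moreover have "of_bool (p $ k \<le> BH_threshold \<alpha> TYPE('k) (Suc r) \<and> BH_index \<alpha> p = Suc r) /
      real (Suc r) = (if r = m then of_bool (k \<in> below) / real (Suc m) else 0)" for k r
    using Suc by (auto simp: below_def)
  ultimately have "(\<Sum>k\<in>N. \<Sum>r<CARD('k). of_bool (p $ k \<le> BH_threshold \<alpha> TYPE('k) (Suc r) \<and>
      BH_index \<alpha> p = Suc r) / real (Suc r)) = (\<Sum>k\<in>N. of_bool (k \<in> below) / real (Suc m))"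
    by (simp add: sum.delta del: of_nat_Suc)
  also have "\<dots> = real (card (below \<inter> N)) / real (Suc m)"
    by (simp add: sum_divide_distrib[symmetric] Int_commute del: of_nat_Suc)
  also have "\<dots> = real (num_false_discoveries N (BH \<alpha> p)) /
      real (max (num_discoveries (BH \<alpha> p)) 1)"
    using BH_eq_below_threshold[OF assms, of p] card_BH[OF assms, of p] Suc
    by (simp add: num_false_discoveries_def num_discoveries_def below_def)
  finally show ?thesis ..
qed

theorem theorem2:
  fixes M :: "'a measure"
    and P :: "'a \<Rightarrow> real ^ 'k::finite"
    and N :: "'k set"
    and \<alpha> :: real
  assumes "prob_space M"
    and "P \<in> borel_measurable M"
    and "\<And>\<omega> k. \<omega> \<in> space M \<Longrightarrow> 0 \<le> P \<omega> $ k"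
    and "\<And>k. k \<in> N \<Longrightarrow> p_variable M (\<lambda>\<omega>. P \<omega> $ k)"
    and "PRDS M P N"
    and "0 < \<alpha>" and "\<alpha> < 1"
  shows "FDR M P N (BH \<alpha>) \<le> \<alpha> * real (card N) / real CARD('k)"
proof -
  interpret prob_space M by fact
  define E where "E k r = {\<omega> \<in> space M. P \<omega> $ k \<le> BH_threshold \<alpha> TYPE('k) (Suc r) \<and>
      BH_index \<alpha> (P \<omega>) = Suc r}" for k r
  have E_meas: "E k r \<in> events" if "k \<in> N" for k r
  proof -
    have [measurable]: "{\<omega> \<in> space M. BH_index \<alpha> (P \<omega>) \<le> s} \<in> events" for s
      using assms(2) by (rule events_BH_index_le)
    have [measurable]: "(\<lambda>\<omega>. P \<omega> $ k) \<in> borel_measurable M"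
      using assms(4)[OF that] by (simp add: p_variable_def)
    have "E k r = {\<omega> \<in> space M. P \<omega> $ k \<le> BH_threshold \<alpha> TYPE('k) (Suc r) \<and>
        BH_index \<alpha> (P \<omega>) \<le> Suc r \<and> \<not> BH_index \<alpha> (P \<omega>) \<le> r}"
      unfolding E_def by auto
    then show ?thesis by simp
  qed
  have "FDR M P N (BH \<alpha>) =
      (\<integral>\<omega>. (\<Sum>k\<in>N. \<Sum>r<CARD('k). indicator (E k r) \<omega> / real (Suc r)) \<partial>M)"
    unfolding FDR_def BH_false_discovery_proportion[OF less_imp_le[OF \<open>0 < \<alpha>\<close>]]
    by (intro Bochner_Integration.integral_cong sum.cong refl) (simp add: E_def indicator_def)
  also have "\<dots> = (\<Sum>k\<in>N. \<Sum>r<CARD('k). prob (E k r) / real (Suc r))"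
    using E_meas
    by (simp add: Bochner_Integration.integral_sum Bochner_Integration.integrable_sum
        emeasure_eq_measure sets.Int_space_eq2 del: of_nat_Suc)
  also have "\<dots> \<le> (\<Sum>k\<in>N. \<alpha> / real CARD('k))"
    unfolding E_def using assms by (intro sum_mono BH_null_contribution[where N = N]) auto
  also have "\<dots> = \<alpha> * real (card N) / real CARD('k)" by simp
  finally show ?thesis .
qed

end
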